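(* Let $\ell\in\mathbb N=\{1,2,3,\dots\}$ and let $\eta\in[0,1]$. Let $(A_1,A_2)$ be the random-walk approximation with block length $\ell$ and parameter $\eta$, let $s_{A_2}$ be the stopping time of $A_2$, and let $G_{II}(\ell,s)=\sum_{k\ge0}\mathbf P(s_{A_2}=k)\,s^k$ be its generating function. If $\eta\le\frac12$, then $G_{II}(\ell,1)=1$.
   Context: A $p$-walk ($p\in[0,1]$) is a random walk on $\mathbb Z$ in which each step is $+1$ with probability $p$ and $-1$ with probability $1-p$, up to a (possibly infinite) stopping time. The random-walk approximation with block length $\ell$ and parameter $\eta$ is a pair $(A_1,A_2)$ of independent walks (independent apart from the stopping rule of $A_2$), both starting at $\ell-1$ at time $t=0$: - $A_1$ is an $\eta$-walk that ends at $s_{A_1}$, the first time $t$ with $A_{1,t}=0$. - $A_2$ is a $(1-\eta)$-walk that ends at $s_{A_2}$, the first time $t$ with $t-A_{2,t}=s_{A_1}+2$. A stopping time is $\infty$ if no such time exists. The sum defining $G_{II}$ runs over finite $k$ only, so $G_{II}(\ell,1)=\mathbf P(s_{A_2}\ne\infty)$. The time $s_{A_2}$ models the classification time of a block of $\ell$ cells in state 1 under the traffic-majority cellular automaton rule with parameter $\eta$.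
   Formalization: The formal statement assumes 0 < η instead of allowing η = 0; at η = 0 the walk A₂ always steps up, so t − A₂,t stays at 1 − ℓ, s_{A₂} = ∞ almost surely, and G_II(ℓ,1) = 0, so the claim fails there. *)

theory Defs
  imports "HOL-Probability.Probability"
begin

text \<open>A stopped walk is represented by the unstopped walk together with its stopping time.\<close>

definition p_walk :: "'a measure \<Rightarrow> real \<Rightarrow> int \<Rightarrow> (nat \<Rightarrow> 'a \<Rightarrow> int) \<Rightarrow> bool" where
  "p_walk M p a A \<longleftrightarrow>
     (\<forall>\<omega>\<in>space M. A 0 \<omega> = a) \<and>
     prob_space.indep_vars M (\<lambda>_. count_space UNIV) (\<lambda>t \<omega>. A (Suc t) \<omega> - A t \<omega>) UNIV \<and>
     (\<forall>t. \<P>(\<omega> in M. A (Suc t) \<omega> - A t \<omega> = 1) = p \<and>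
          \<P>(\<omega> in M. A (Suc t) \<omega> - A t \<omega> = -1) = 1 - p)"

definition first_time :: "(nat \<Rightarrow> bool) \<Rightarrow> enat" where
  "first_time P = (if \<exists>t. P t then enat (LEAST t. P t) else \<infinity>)"

definition stop_A1 :: "(nat \<Rightarrow> 'a \<Rightarrow> int) \<Rightarrow> 'a \<Rightarrow> enat" where
  "stop_A1 A1 \<omega> = first_time (\<lambda>t. A1 t \<omega> = 0)"

definition stop_A2 :: "(nat \<Rightarrow> 'a \<Rightarrow> int) \<Rightarrow> (nat \<Rightarrow> 'a \<Rightarrow> int) \<Rightarrow> 'a \<Rightarrow> enat" where
  "stop_A2 A1 A2 \<omega> = first_time (\<lambda>t. case stop_A1 A1 \<omega> of
     enat k \<Rightarrow> int t - A2 t \<omega> = int k + 2 | \<infinity> \<Rightarrow> False)"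

text \<open>Independence is imposed on the unstopped walks, as random functions of time; the stopped
  walks are dependent because the stopping rule of the second involves the first.\<close>

definition random_walk_approximation ::
    "'a measure \<Rightarrow> nat \<Rightarrow> real \<Rightarrow> (nat \<Rightarrow> 'a \<Rightarrow> int) \<Rightarrow> (nat \<Rightarrow> 'a \<Rightarrow> int) \<Rightarrow> bool" where
  "random_walk_approximation M l \<eta> A1 A2 \<longleftrightarrow>
     prob_space M \<and>
     p_walk M \<eta> (int l - 1) A1 \<and>
     p_walk M (1 - \<eta>) (int l - 1) A2 \<and>
     prob_space.indep_var M
       (\<Pi>\<^sub>M t\<in>UNIV. count_space UNIV) (\<lambda>\<omega> t. A1 t \<omega>)
       (\<Pi>\<^sub>M t\<in>UNIV. count_space UNIV) (\<lambda>\<omega> t. A2 t \<omega>)"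

text \<open>For \<open>\<eta> = 0\<close> the second walk almost surely never steps down, so \<open>t - A2 t\<close> stays at
  \<open>1 - l\<close>, its stopping time is infinite, and the generating function below vanishes identically.\<close>

definition G_II ::
    "'a measure \<Rightarrow> (nat \<Rightarrow> 'a \<Rightarrow> int) \<Rightarrow> (nat \<Rightarrow> 'a \<Rightarrow> int) \<Rightarrow> real \<Rightarrow> real" where
  "G_II M A1 A2 s = (\<Sum>k. \<P>(\<omega> in M. stop_A2 A1 A2 \<omega> = enat k) * s ^ k)"

end

(* The concave potential sqrt is a nonnegative supermartingale along the first walk killed at 0,
   as eta <= 1/2. Since sqrt is strictly concave, its expectation loses at each time a fixed
   positive multiple of the mass at any given site n > 0, so the mass at every site tends to 0;
   since sqrt is unbounded, no mass escapes to infinity. Hence the first walk hits 0 almost surely.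
   The second walk steps down infinitely often almost surely, so t - A2 t runs through all
   numbers >= 1 - l of the parity of 1 - l, and s_A1 + 2 is such a number. *)
theory Submission
  imports Defs
begin

section \<open>Decay of the mass of a walk killed at 0\<close>

text \<open>Summation by parts: one step of the walk is moved from the mass \<open>u\<close> to the
  test function \<open>g\<close>. With \<open>g 0 = 0\<close>, mass absorbed at 0 is not counted;
  with \<open>u 0 = 0\<close>, the truncated \<open>n - 1\<close> at \<open>n = 0\<close> is
  harmless.\<close>

lemma sum_walk_step:
  fixes u u' g :: "nat \<Rightarrow> real"
  assumes "g 0 = 0" "u 0 = 0" and supp: "\<And>n. n > L \<Longrightarrow> u n = 0"
    and rec: "\<And>n. u' (Suc n) = p * u n + (1 - p) * u (n + 2)"
  shows "(\<Sum>n\<le>Suc L. g n * u' n) = (\<Sum>n\<le>L. u n * (p * g (Suc n) + (1 - p) * g (n - 1)))"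
proof -
  have "(\<Sum>n\<le>Suc L. g n * u' n) = (\<Sum>n\<le>L. g (Suc n) * u' (Suc n))"
    by (simp add: sum.atMost_Suc_shift assms(1) del: sum.atMost_Suc)
  also have "\<dots> = (\<Sum>n\<le>L. u n * (p * g (Suc n))) + (1 - p) * (\<Sum>n\<le>L. g (Suc n) * u (Suc (Suc n)))"
    by (simp add: rec sum_distrib_left algebra_simps flip: sum.distrib)
  \<comment> \<open>Two index shifts lead to \<open>u n\<close>: the first adds a term with
    \<open>g 0 = 0\<close>, the second one with \<open>u 0 = 0\<close>. Then \<open>supp\<close>
    removes the sites beyond \<open>L\<close>.\<close>
  also have "(\<Sum>n\<le>L. g (Suc n) * u (Suc (Suc n))) = (\<Sum>n\<le>Suc L. g n * u (Suc n))"
    by (simp add: sum.atMost_Suc_shift assms(1) del: sum.atMost_Suc)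
  also have "\<dots> = (\<Sum>n\<le>Suc (Suc L). g (n - 1) * u n)"
    by (subst (2) sum.atMost_Suc_shift) (simp add: assms(2) del: sum.atMost_Suc)
  also have "\<dots> = (\<Sum>n\<le>L. g (n - 1) * u n)"
    by (simp add: supp)
  finally show ?thesis
    by (simp add: sum_distrib_left algebra_simps flip: sum.distrib)
qed

lemma sqrt_strict_midconcave:
  fixes x :: real
  assumes "x \<ge> 1"
  shows "(sqrt (x + 1) + sqrt (x - 1)) / 2 < sqrt x"
proof -
  have "(sqrt (x + 1) + sqrt (x - 1))\<^sup>2 = 2 * x + 2 * sqrt (x\<^sup>2 - 1)"
    using assms by (simp add: power2_sum flip: real_sqrt_mult) (simp add: power2_eq_square algebra_simps)
  also have "sqrt (x\<^sup>2 - 1) < sqrt (x\<^sup>2)"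
    by (rule real_sqrt_less_mono) simp
  hence "2 * x + 2 * sqrt (x\<^sup>2 - 1) < (2 * sqrt x)\<^sup>2"
    using assms by (simp add: power_mult_distrib)
  finally have "sqrt (x + 1) + sqrt (x - 1) < 2 * sqrt x"
    by (rule power2_less_imp_less) (use assms in simp)
  thus ?thesis by simp
qed

text \<open>\<open>u t n\<close> stands for the probability that a walk from \<open>a\<close> killed at \<open>0\<close> is alive at time \<open>t\<close>
  and at position \<open>n\<close>.\<close>

lemma killed_walk_mass_tendsto_0:
  fixes u :: "nat \<Rightarrow> nat \<Rightarrow> real"
  assumes p: "0 \<le> p" "p \<le> 1 / 2"
    and nonneg: "\<And>t n. 0 \<le> u t n"
    and zero: "\<And>t. u t 0 = 0"
    and supp0: "\<And>n. n > a \<Longrightarrow> u 0 n = 0"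
    and rec: "\<And>t n. u (Suc t) (Suc n) = p * u t n + (1 - p) * u t (n + 2)"
  shows "(\<lambda>t. \<Sum>n\<le>a + t. u t n) \<longlonglongrightarrow> 0"
proof -
  have supp: "u t n = 0" if "n > a + t" for t n
    using that
  proof (induction t arbitrary: n)
    case (Suc t)
    then obtain m where "n = Suc m" "m > a + t" by (cases n) auto
    with Suc.IH show ?case by (simp add: rec)
  qed (use supp0 in auto)
  \<comment> \<open>\<open>c n\<close> is the expected loss of sqrt in a symmetric step from
    \<open>n\<close>. The terms with \<open>c 0\<close> vanish since
    \<open>u t 0 = 0\<close>.\<close>
  define c where "c n = sqrt (real n) - (sqrt (real n + 1) + sqrt (real n - 1)) / 2" for n
  have c_pos: "c n > 0" if "n \<ge> 1" for n
    using sqrt_strict_midconcave[of "real n"] that by (simp add: c_def)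
  define F where "F t = (\<Sum>n\<le>a + t. sqrt (real n) * u t n)" for t
  have F_nonneg: "F t \<ge> 0" for t
    by (simp add: F_def sum_nonneg nonneg)
  have drop: "(\<Sum>n\<le>a + t. u t n * c n) \<le> F t - F (Suc t)" for t
  proof -
    have "F (Suc t) = (\<Sum>n\<le>a + t. u t n * (p * sqrt (real (Suc n)) + (1 - p) * sqrt (real (n - 1))))"
      unfolding F_def add_Suc_right
      by (rule sum_walk_step) (auto simp: zero supp rec)
    also have "\<dots> \<le> (\<Sum>n\<le>a + t. u t n * (sqrt (real n) - c n))"
    proof (rule sum_mono)
      fix n
      show "u t n * (p * sqrt (real (Suc n)) + (1 - p) * sqrt (real (n - 1)))
              \<le> u t n * (sqrt (real n) - c n)"
      proof (cases n)
        case (Suc m)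
        \<comment> \<open>Passing from \<open>p\<close> to 1/2 moves weight \<open>1 / 2 - p\<close>
          from the lower to the upper neighbour. As sqrt increases, the symmetric average bounds the
          biased one.\<close>
        have "(1 / 2 - p) * (sqrt (real n + 1) - sqrt (real m)) \<ge> 0"
          using p Suc by simp
        hence "p * sqrt (real (Suc n)) + (1 - p) * sqrt (real (n - 1)) \<le> sqrt (real n) - c n"
          unfolding c_def by (simp add: Suc algebra_simps)
        thus ?thesis by (rule mult_left_mono) (rule nonneg)
      qed (simp add: zero)
    qed
    finally show ?thesis
      by (simp add: F_def right_diff_distrib sum_subtractf mult.commute)
  qed
  have term_nonneg: "u t n * c n \<ge> 0" for t n
    using c_pos[of n] by (cases n) (auto simp: zero nonneg)
  have F_dec: "F (Suc t) \<le> F t" for t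
    using drop[of t] sum_nonneg[of "{..a + t}" "\<lambda>n. u t n * c n"] term_nonneg by force
  have "decseq F"
    by (rule decseq_SucI) (rule F_dec)
  then obtain l where l: "F \<longlonglongrightarrow> l"
    using F_nonneg by (metis decseq_convergent)
  \<comment> \<open>The decrements of the convergent \<open>F\<close> bound
    \<open>u t n * c n\<close> for each fixed \<open>n\<close>, and \<open>c n\<close> is positive
    for \<open>n > 0\<close>.\<close>
  have diff: "(\<lambda>t. F t - F (Suc t)) \<longlonglongrightarrow> 0"
    using tendsto_diff[OF l LIMSEQ_Suc[OF l]] by simp
  have u_lim: "(\<lambda>t. u t n) \<longlonglongrightarrow> 0" for n
  proof (cases "n = 0")
    case False
    hence c: "c n > 0" using c_pos by simp
    have le: "u t n * c n \<le> F t - F (Suc t)" for t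
    proof (cases "n \<le> a + t")
      case True
      hence "u t n * c n \<le> (\<Sum>n\<le>a + t. u t n * c n)"
        by (intro member_le_sum) (auto simp: term_nonneg)
      thus ?thesis using drop[of t] by simp
    qed (use F_dec supp in auto)
    have "(\<lambda>t. u t n * c n) \<longlonglongrightarrow> 0"
      by (rule tendsto_sandwich[OF _ _ tendsto_const diff]) (auto simp: le term_nonneg)
    hence "(\<lambda>t. u t n * c n / c n) \<longlonglongrightarrow> 0 / c n"
      by (rule tendsto_divide) (use c in auto)
    thus ?thesis using c by simp
  qed (simp add: zero)
  have F_le: "F t \<le> F 0" for t
    using \<open>decseq F\<close> by (simp add: decseq_def)
  \<comment> \<open>Markov's inequality for sqrt: at sites from \<open>K\<close> on, 1 is at most
    \<open>sqrt n / sqrt K\<close>. The bound on the tail is uniform in \<open>t\<close>.\<close>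
  have split: "(\<Sum>n\<le>a + t. u t n) \<le> (\<Sum>n<K. u t n) + F 0 / sqrt (real K)" if "K > 0" for t K
  proof -
    have "(\<Sum>n\<le>a + t. u t n) \<le> (\<Sum>n\<in>{..<K} \<union> {K..a + t}. u t n)"
      by (rule sum_mono2) (auto simp: nonneg)
    also have "\<dots> = (\<Sum>n<K. u t n) + (\<Sum>n=K..a + t. u t n)"
      by (rule sum.union_disjoint) auto
    also have "(\<Sum>n=K..a + t. u t n) \<le> (\<Sum>n=K..a + t. sqrt (real n) * u t n / sqrt (real K))"
    proof (rule sum_mono)
      fix n assume "n \<in> {K..a + t}"
      hence "sqrt (real K) * u t n \<le> sqrt (real n) * u t n"
        by (intro mult_right_mono) (auto simp: nonneg)
      thus "u t n \<le> sqrt (real n) * u t n / sqrt (real K)"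
        using that by (simp add: field_simps)
    qed
    also have "\<dots> = (\<Sum>n=K..a + t. sqrt (real n) * u t n) / sqrt (real K)"
      by (simp add: sum_divide_distrib)
    also have "(\<Sum>n=K..a + t. sqrt (real n) * u t n) \<le> F t"
      unfolding F_def by (rule sum_mono2) (auto simp: nonneg)
    also have "F t \<le> F 0" by (rule F_le)
    finally show ?thesis by (simp add: divide_right_mono)
  qed
  show ?thesis
  proof (rule LIMSEQ_I)
    fix e :: real assume e: "e > 0"
    have "(\<lambda>K. F 0 / sqrt (real K)) \<longlonglongrightarrow> 0"
      by (intro real_tendsto_divide_at_top[OF tendsto_const]
          filterlim_compose[OF sqrt_at_top filterlim_real_sequentially])
    hence "\<forall>\<^sub>F K in sequentially. F 0 / sqrt (real K) < e / 2"
      using e by (intro order_tendstoD(2)) auto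
    hence "\<forall>\<^sub>F K in sequentially. F 0 / sqrt (real K) < e / 2 \<and> K > 0"
      using eventually_gt_at_top[of 0] by eventually_elim auto
    \<comment> \<open>\<open>K\<close> is fixed before \<open>t\<close>, so only finitely many sites
      remain whose mass must become small.\<close>
    then obtain K where K: "F 0 / sqrt (real K) < e / 2" "K > 0"
      using eventually_happens'[OF sequentially_bot] by blast
    have "(\<lambda>t. \<Sum>n<K. u t n) \<longlonglongrightarrow> (\<Sum>n<K. 0)"
      by (intro tendsto_sum u_lim)
    hence "\<forall>\<^sub>F t in sequentially. (\<Sum>n<K. u t n) < e / 2"
      using e by (intro order_tendstoD(2)) auto
    hence "\<forall>\<^sub>F t in sequentially. norm ((\<Sum>n\<le>a + t. u t n) - 0) < e"
    proof eventually_elim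
      case (elim t)
      have "(\<Sum>n\<le>a + t. u t n) \<ge> 0" by (simp add: sum_nonneg nonneg)
      moreover have "(\<Sum>n\<le>a + t. u t n) < e"
        using split[OF K(2), of t] K(1) elim by linarith
      ultimately show ?case by simp
    qed
    thus "\<exists>no. \<forall>t\<ge>no. norm ((\<Sum>n\<le>a + t. u t n) - 0) < e"
      by (simp add: eventually_sequentially)
  qed
qed

section \<open>Almost sure behaviour of a single walk\<close>

context prob_space
begin

text \<open>Independence supplies measurability of the increments only; the positions inherit it by
  summation from the constant start.\<close>

lemma p_walk_measurable:
  assumes "p_walk M p a A"
  shows "A t \<in> measurable M (count_space UNIV)"
proof (induction t)
  case 0
  have "A 0 \<omega> = a" if "\<omega> \<in> space M" for \<omega>
    using assms that by (simp add: p_walk_def)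
  thus ?case by (simp cong: measurable_cong)
next
  case (Suc t)
  have [measurable]: "(\<lambda>\<omega>. A (Suc t) \<omega> - A t \<omega>) \<in> measurable M (count_space UNIV)"
    using assms by (auto simp: p_walk_def indep_vars_def)
  note [measurable] = Suc.IH
  have "(\<lambda>\<omega>. (A (Suc t) \<omega> - A t \<omega>) + A t \<omega>) \<in> measurable M (count_space UNIV)"
    by measurable
  thus ?case by simp
qed

text \<open>The two disjoint events have probabilities \<open>p\<close> and \<open>1 - p\<close>,
  which exhaust the total mass; countably many times allow one common null set.\<close>

lemma p_walk_AE_step:
  assumes "p_walk M p a A"
  shows "AE \<omega> in M. \<forall>t. A (Suc t) \<omega> - A t \<omega> \<in> {1, -1}"
  unfolding AE_all_countable
proof
  fix t
  note [measurable] = p_walk_measurable[OF assms]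
  have "prob {\<omega>\<in>space M. A (Suc t) \<omega> - A t \<omega> \<in> {1, -1}}
      = prob ({\<omega>\<in>space M. A (Suc t) \<omega> - A t \<omega> = 1} \<union> {\<omega>\<in>space M. A (Suc t) \<omega> - A t \<omega> = -1})"
    by (rule arg_cong[where f = prob]) auto
  also have "\<dots> = prob {\<omega>\<in>space M. A (Suc t) \<omega> - A t \<omega> = 1}
      + prob {\<omega>\<in>space M. A (Suc t) \<omega> - A t \<omega> = -1}"
    by (rule finite_measure_Union) auto
  also have "\<dots> = 1"
    using assms by (simp add: p_walk_def)
  finally show "AE \<omega> in M. A (Suc t) \<omega> - A t \<omega> \<in> {1, -1}"
    by (subst (asm) prob_Collect_eq_1) auto
qed

lemma p_walk_eq_sum:
  assumes "p_walk M p a A" "\<omega> \<in> space M"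
  shows "A t \<omega> = a + (\<Sum>i<t. A (Suc i) \<omega> - A i \<omega>)"
  using assms sum_lessThan_telescope[of "\<lambda>i. A i \<omega>" t] by (simp add: p_walk_def)

lemma measurable_count_space_add:
  fixes f g :: "'b \<Rightarrow> int"
  assumes [measurable]: "f \<in> measurable N (count_space UNIV)" "g \<in> measurable N (count_space UNIV)"
  shows "(\<lambda>z. f z + g z) \<in> measurable N (count_space UNIV)"
  by measurable

text \<open>Makes events about the path up to time \<open>t\<close> measurable in the first
  \<open>t\<close> increments; \<open>s \<le> t\<close> keeps all summands inside the
  product.\<close>

lemma measurable_PiM_partial_sum:
  fixes s t :: nat
  assumes "s \<le> t"
  shows "(\<lambda>z. (\<Sum>i<s. z i :: int)) \<in> measurable (\<Pi>\<^sub>M i\<in>{..<t}. count_space UNIV) (count_space UNIV)"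
  using assms
proof (induction s)
  case (Suc s)
  have "(\<lambda>z. z s :: int) \<in> measurable (\<Pi>\<^sub>M i\<in>{..<t}. count_space UNIV) (count_space UNIV)"
    by (rule measurable_component_singleton) (use Suc.prems in simp)
  with Suc.IH[OF Suc_leD[OF Suc.prems]] show ?case
    unfolding sum.lessThan_Suc by (rule measurable_count_space_add)
qed simp

text \<open>The past up to time \<open>t\<close> is a function of the increments with index below
  \<open>t\<close>, and these are jointly independent of increment \<open>t\<close>.\<close>

lemma p_walk_past_indep_step:
  assumes walk: "p_walk M p a A"
  shows "\<P>(\<omega> in M. ((\<forall>s\<le>t. A s \<omega> \<noteq> 0) \<and> A t \<omega> = x) \<and> A (Suc t) \<omega> - A t \<omega> = d)
       = \<P>(\<omega> in M. (\<forall>s\<le>t. A s \<omega> \<noteq> 0) \<and> A t \<omega> = x) * \<P>(\<omega> in M. A (Suc t) \<omega> - A t \<omega> = d)"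
proof -
  let ?X = "\<lambda>t \<omega>. A (Suc t) \<omega> - A t \<omega>" and ?N = "\<lambda>I. \<Pi>\<^sub>M i\<in>I. count_space (UNIV :: int set)"
  have indep: "indep_vars (\<lambda>_. count_space UNIV) ?X UNIV"
    using walk by (simp add: p_walk_def)
  have iv: "indep_var (?N {..<t}) (\<lambda>\<omega>. restrict (\<lambda>i. ?X i \<omega>) {..<t})
                  (?N {t}) (\<lambda>\<omega>. restrict (\<lambda>i. ?X i \<omega>) {t})"
    by (rule indep_var_restrict[OF indep]) auto
  \<comment> \<open>The past, written on sequences of increments: positions become \<open>a\<close>
    plus partial sums.\<close>
  define E where "E = {z \<in> space (?N {..<t}). (\<forall>s\<le>t. a + (\<Sum>i<s. z i) \<noteq> 0) \<and> a + (\<Sum>i<t. z i) = x}"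
  define D where "D = {z \<in> space (?N {t}). z t = d}"
  have E: "E \<in> sets (?N {..<t})"
  proof -
    note [measurable] = measurable_PiM_partial_sum
    \<comment> \<open>The guard matters: for \<open>s > t\<close> the partial sum would read
      coordinates outside the product.\<close>
    have "Measurable.pred (?N {..<t}) (\<lambda>z. s \<le> t \<longrightarrow> a + (\<Sum>i<s. z i) \<noteq> 0)" for s
      by (cases "s \<le> t") simp_all
    note [measurable] = this
    show ?thesis unfolding E_def by measurable
  qed
  have D: "D \<in> sets (?N {t})"
    unfolding D_def by measurable
  have EE: "(\<lambda>\<omega>. restrict (\<lambda>i. ?X i \<omega>) {..<t}) -` E \<inter> space M
      = {\<omega>\<in>space M. (\<forall>s\<le>t. A s \<omega> \<noteq> 0) \<and> A t \<omega> = x}"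
    unfolding E_def by (auto simp: space_PiM p_walk_eq_sum[OF walk, symmetric])
  have DD: "(\<lambda>\<omega>. restrict (\<lambda>i. ?X i \<omega>) {t}) -` D \<inter> space M = {\<omega>\<in>space M. ?X t \<omega> = d}"
    unfolding D_def by (auto simp: space_PiM)
  have "{\<omega>\<in>space M. ((\<forall>s\<le>t. A s \<omega> \<noteq> 0) \<and> A t \<omega> = x) \<and> ?X t \<omega> = d}
      = (\<lambda>\<omega>. (restrict (\<lambda>i. ?X i \<omega>) {..<t}, restrict (\<lambda>i. ?X i \<omega>) {t})) -` (E \<times> D) \<inter> space M"
    using EE DD by auto
  thus ?thesis
    using indep_varD[OF iv E D] by (simp only: EE DD)
qed

text \<open>The probability of never hitting 0 is at most the mass still alive at time
  \<open>t\<close>, for every \<open>t\<close>, and that mass tends to 0.\<close>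

lemma p_walk_AE_hits_0:
  assumes walk: "p_walk M p (int a) A" and p: "0 \<le> p" "p \<le> 1 / 2"
  shows "AE \<omega> in M. \<exists>t. A t \<omega> = 0"
proof -
  note [measurable] = p_walk_measurable[OF walk]
  define u where "u t n = \<P>(\<omega> in M. (\<forall>s\<le>t. A s \<omega> \<noteq> 0) \<and> A t \<omega> = int n)" for t n
  have start: "A 0 \<omega> = int a" if "\<omega> \<in> space M" for \<omega>
    using walk that by (simp add: p_walk_def)
  \<comment> \<open>A walk alive at \<open>n + 1\<close> came up from \<open>n\<close> or down from
    \<open>n + 2\<close>. This holds only almost surely, since the increments are 1 or -1 only
    almost surely.\<close>
  have rec: "u (Suc t) (Suc n) = p * u t n + (1 - p) * u t (n + 2)" for t n
  proof -
    let ?S = "\<lambda>x d. {\<omega>\<in>space M. ((\<forall>s\<le>t. A s \<omega> \<noteq> 0) \<and> A t \<omega> = x) \<and> A (Suc t) \<omega> - A t \<omega> = d}"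
    have "u (Suc t) (Suc n) = prob (?S (int n) 1 \<union> ?S (int (n + 2)) (-1))"
      unfolding u_def
    proof (rule finite_measure_eq_AE)
      show "AE \<omega> in M. (\<omega> \<in> {\<omega>\<in>space M. (\<forall>s\<le>Suc t. A s \<omega> \<noteq> 0) \<and> A (Suc t) \<omega> = int (Suc n)})
          = (\<omega> \<in> ?S (int n) 1 \<union> ?S (int (n + 2)) (-1))"
        using p_walk_AE_step[OF walk]
      proof eventually_elim
        case (elim \<omega>)
        from elim[rule_format, of t] show ?case by (auto simp: le_Suc_eq)
      qed
    qed measurable
    also have "\<dots> = prob (?S (int n) 1) + prob (?S (int (n + 2)) (-1))"
      by (rule finite_measure_Union) auto
    also have "\<dots> = u t n * p + u t (n + 2) * (1 - p)"
      unfolding p_walk_past_indep_step[OF walk] u_def using walk by (simp add: p_walk_def)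
    finally show ?thesis by (simp add: mult.commute)
  qed
  have lim: "(\<lambda>t. \<Sum>n\<le>a + t. u t n) \<longlonglongrightarrow> 0"
  proof (rule killed_walk_mass_tendsto_0[where u = u and p = p and a = a])
    show "u t 0 = 0" for t
    proof -
      have "{\<omega>\<in>space M. (\<forall>s\<le>t. A s \<omega> \<noteq> 0) \<and> A t \<omega> = int 0} = {}" by auto
      thus ?thesis unfolding u_def by (simp only: measure_empty)
    qed
    show "u 0 n = 0" if "n > a" for n
    proof -
      have "{\<omega>\<in>space M. (\<forall>s\<le>0. A s \<omega> \<noteq> 0) \<and> A 0 \<omega> = int n} = {}"
        using that by (auto simp: start)
      thus ?thesis unfolding u_def by (simp only: measure_empty)
    qed
  qed (use p rec in \<open>auto simp: u_def\<close>)
  have le: "prob {\<omega>\<in>space M. \<forall>t. A t \<omega> \<noteq> 0} \<le> (\<Sum>n\<le>a + t. u t n)" for t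
  proof -
    let ?B = "\<lambda>n. {\<omega>\<in>space M. (\<forall>s\<le>t. A s \<omega> \<noteq> 0) \<and> A t \<omega> = int n}"
    have "prob {\<omega>\<in>space M. \<forall>t. A t \<omega> \<noteq> 0} \<le> prob (\<Union>n\<in>{..a + t}. ?B n)"
    proof (rule finite_measure_mono_AE)
      show "AE \<omega> in M. \<omega> \<in> {\<omega>\<in>space M. \<forall>t. A t \<omega> \<noteq> 0} \<longrightarrow> \<omega> \<in> (\<Union>n\<in>{..a + t}. ?B n)"
        using p_walk_AE_step[OF walk]
      proof eventually_elim
        case (elim \<omega>)
        show ?case
        proof
          assume \<omega>: "\<omega> \<in> {\<omega>\<in>space M. \<forall>t. A t \<omega> \<noteq> 0}"
          \<comment> \<open>Unit steps cannot jump over 0, so a path avoiding 0 stays positive, and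
            it rises by at most 1 per step.\<close>
          have "0 < A s \<omega> \<and> A s \<omega> \<le> int (a + s)" for s
          proof (induction s)
            case 0
            have "A 0 \<omega> \<noteq> 0" using \<omega> by blast
            thus ?case using start \<omega> by auto
          next
            case (Suc s)
            have "A (Suc s) \<omega> \<noteq> 0" using \<omega> by blast
            thus ?case using Suc elim[rule_format, of s] by auto
          qed
          from this[of t] have "nat (A t \<omega>) \<le> a + t" "A t \<omega> = int (nat (A t \<omega>))"
            by auto
          thus "\<omega> \<in> (\<Union>n\<in>{..a + t}. ?B n)" using \<omega> by blast
        qed
      qed
    qed measurable
    also have "\<dots> \<le> (\<Sum>n\<le>a + t. prob (?B n))"
      by (rule finite_measure_subadditive_finite) auto
    finally show ?thesis by (simp add: u_def)
  qed
  have "prob {\<omega>\<in>space M. \<forall>t. A t \<omega> \<noteq> 0} \<le> 0"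
    by (rule LIMSEQ_le_const[OF lim]) (use le in auto)
  hence "prob {\<omega>\<in>space M. \<forall>t. A t \<omega> \<noteq> 0} = 0"
    by (simp add: measure_le_0_iff)
  hence "AE \<omega> in M. \<not> (\<forall>t. A t \<omega> \<noteq> 0)"
    by (subst (asm) prob_Collect_eq_0) auto
  thus ?thesis by simp
qed

text \<open>By independence, \<open>n + 1\<close> consecutive steps from time \<open>m\<close> on
  are all upward with probability \<open>p ^ Suc n\<close>, which tends to 0 as
  \<open>p < 1\<close>.\<close>

lemma p_walk_AE_down_steps:
  assumes walk: "p_walk M p a A" and p: "0 \<le> p" "p < 1"
  shows "AE \<omega> in M. \<forall>m. \<exists>t\<ge>m. A (Suc t) \<omega> - A t \<omega> = -1"
  unfolding AE_all_countable
proof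
  fix m
  note [measurable] = p_walk_measurable[OF walk]
  let ?X = "\<lambda>t \<omega>. A (Suc t) \<omega> - A t \<omega>"
  let ?never = "{\<omega>\<in>space M. \<forall>t\<ge>m. ?X t \<omega> \<noteq> -1}"
  have indep: "indep_vars (\<lambda>_. count_space UNIV) ?X UNIV"
    using walk by (simp add: p_walk_def)
  have one: "prob (?X t -` {1} \<inter> space M) = p" for t
  proof -
    have "?X t -` {1} \<inter> space M = {\<omega>\<in>space M. ?X t \<omega> = 1}" by auto
    thus ?thesis using walk by (simp add: p_walk_def)
  qed
  have le: "prob ?never \<le> p ^ Suc n" for n
  proof -
    have "prob ?never \<le> prob (\<Inter>t\<in>{m..m + n}. ?X t -` {1} \<inter> space M)"
    proof (rule finite_measure_mono_AE)
      show "AE \<omega> in M. \<omega> \<in> ?never \<longrightarrow> \<omega> \<in> (\<Inter>t\<in>{m..m + n}. ?X t -` {1} \<inter> space M)"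
        using p_walk_AE_step[OF walk] by eventually_elim auto
    qed measurable
    also have "\<dots> = (\<Prod>t\<in>{m..m + n}. prob (?X t -` {1} \<inter> space M))"
      by (rule indep_varsD[OF indep]) auto
    also have "\<dots> = p ^ Suc n" by (simp add: one)
    finally show ?thesis .
  qed
  have "(\<lambda>n. p ^ Suc n) \<longlonglongrightarrow> 0"
    using p by (intro LIMSEQ_Suc LIMSEQ_power_zero) auto
  hence "prob ?never \<le> 0"
    by (rule LIMSEQ_le_const) (use le in auto)
  hence "prob ?never = 0"
    by (simp add: measure_le_0_iff)
  hence "AE \<omega> in M. \<not> (\<forall>t\<ge>m. ?X t \<omega> \<noteq> -1)"
    by (subst (asm) prob_Collect_eq_0) auto
  thus "AE \<omega> in M. \<exists>t\<ge>m. ?X t \<omega> = -1" by simp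
qed

end

section \<open>Pathwise analysis of the stopping times\<close>

text \<open>Meant for \<open>t - A2 t\<close>, which stays put on an up step and gains 2 on a down
  step; it therefore skips no value of the right parity.\<close>

lemma counter_hits_every_value:
  fixes D :: "nat \<Rightarrow> int"
  assumes step: "\<And>t. D (Suc t) - D t \<in> {0, 2}" and inf: "\<And>m. \<exists>t\<ge>m. D (Suc t) - D t = 2"
  shows "\<exists>t. D t = D 0 + 2 * int N"
proof (induction N)
  case (Suc N)
  then obtain t where t: "D t = D 0 + 2 * int N" by blast
  \<comment> \<open>The first jump at or after \<open>t\<close>: the counter is constant up to
    \<open>s\<close>, so the value at \<open>Suc s\<close> is exactly 2 more than at
    \<open>t\<close>.\<close>
  define s where "s = (LEAST s. s \<ge> t \<and> D (Suc s) - D s = 2)"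
  have s: "s \<ge> t" "D (Suc s) - D s = 2"
    using LeastI_ex[OF inf[of t, unfolded Bex_def]] unfolding s_def by auto
  have flat: "D r = D t" if "t \<le> r" "r \<le> s" for r
    using that
  proof (induction r rule: dec_induct)
    case (step r)
    hence "\<not> (r \<ge> t \<and> D (Suc r) - D r = 2)"
      using not_less_Least[of r "\<lambda>s. s \<ge> t \<and> D (Suc s) - D s = 2"] by (auto simp: s_def)
    with step assms(1)[of r] show ?case by auto
  qed simp
  show ?case using flat[of s] s t by (intro exI[of _ "Suc s"]) simp
qed auto

text \<open>Trades \<open>LEAST\<close> for quantifiers over the naturals, which preserve
  measurability.\<close>

lemma first_time_eq_enat_iff:
  "first_time P = enat k \<longleftrightarrow> P k \<and> (\<forall>j<k. \<not> P j)"
proof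
  assume "first_time P = enat k"
  hence "\<exists>t. P t" "k = (LEAST t. P t)"
    by (auto simp: first_time_def split: if_splits)
  thus "P k \<and> (\<forall>j<k. \<not> P j)"
    by (auto intro: LeastI_ex dest: not_less_Least)
next
  assume *: "P k \<and> (\<forall>j<k. \<not> P j)"
  hence "(LEAST t. P t) = k"
    by (intro Least_equality) (auto simp: not_less[symmetric])
  with * show "first_time P = enat k"
    by (auto simp: first_time_def)
qed

lemma first_time_finite_iff: "(\<exists>k. first_time P = enat k) \<longleftrightarrow> (\<exists>t. P t)"
  by (auto simp: first_time_def)

text \<open>Replaces the case distinction on \<open>enat\<close> by a countable quantifier, again
  for measurability.\<close>

lemma stop_A2_alt:
  "stop_A2 A1 A2 \<omega> = first_time (\<lambda>t. \<exists>k. stop_A1 A1 \<omega> = enat k \<and> int t - A2 t \<omega> = int k + 2)"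
  unfolding stop_A2_def by (rule arg_cong[where f = first_time]) (auto split: enat.split)

text \<open>Parity is the point: \<open>t - A2 t\<close> takes only values congruent to
  \<open>1 - l\<close> modulo 2, and the hitting time of the first walk makes the target
  \<open>k + 2\<close> one of them.\<close>

lemma stop_A2_finite:
  fixes A1 A2 :: "nat \<Rightarrow> 'a \<Rightarrow> int"
  assumes start: "A1 0 \<omega> = int l - 1" "A2 0 \<omega> = int l - 1"
    and step1: "\<forall>t. A1 (Suc t) \<omega> - A1 t \<omega> \<in> {1, -1}"
    and step2: "\<forall>t. A2 (Suc t) \<omega> - A2 t \<omega> \<in> {1, -1}"
    and hit: "\<exists>t. A1 t \<omega> = 0"
    and down: "\<forall>m. \<exists>t\<ge>m. A2 (Suc t) \<omega> - A2 t \<omega> = -1"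
  shows "\<exists>k. stop_A2 A1 A2 \<omega> = enat k"
proof -
  obtain k where k: "stop_A1 A1 \<omega> = enat k"
    using hit first_time_finite_iff[of "\<lambda>t. A1 t \<omega> = 0"] unfolding stop_A1_def by blast
  hence A1k: "A1 k \<omega> = 0"
    by (simp add: stop_A1_def first_time_eq_enat_iff)
  \<comment> \<open>Position plus time keeps its parity along a walk with steps of size 1.\<close>
  have "even (A1 t \<omega> - (int l - 1) + int t)" for t
  proof (induction t)
    case (Suc t)
    have "A1 (Suc t) \<omega> = A1 t \<omega> + 1 \<or> A1 (Suc t) \<omega> = A1 t \<omega> - 1"
      using step1[rule_format, of t] by auto
    with Suc show ?case by auto
  qed (simp add: start)
  from this[of k] have "even (int k + 1 + int l)"
    using A1k by auto
  hence "even (k + 1 + l)"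
    by presburger
  \<comment> \<open>\<open>N\<close> is the number of down steps the second walk needs:
    \<open>1 - l + 2 * N = k + 2\<close>.\<close>
  then obtain N where N: "k + 1 + l = 2 * N"
    by (elim evenE)
  define D where "D t = int t - A2 t \<omega>" for t
  have "\<exists>t. D t = D 0 + 2 * int N"
  proof (rule counter_hits_every_value)
    show "D (Suc t) - D t \<in> {0, 2}" for t
      using step2[rule_format, of t] by (auto simp: D_def)
    show "\<exists>t\<ge>m. D (Suc t) - D t = 2" for m
      using down[rule_format, of m] by (force simp: D_def)
  qed
  then obtain t where "int t - A2 t \<omega> = 1 - int l + 2 * int N"
    by (auto simp: D_def start)
  hence "int t - A2 t \<omega> = int k + 2"
    using N by linarith
  with k show ?thesis
    unfolding stop_A2_alt first_time_finite_iff by blast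
qed

section \<open>The value of the generating function at 1\<close>

theorem theorem10:
  fixes M :: "'a measure" and l :: nat and \<eta> :: real and A1 A2 :: "nat \<Rightarrow> 'a \<Rightarrow> int"
  assumes "l \<ge> 1"
    and "0 < \<eta>" and "\<eta> \<le> 1"
    and "random_walk_approximation M l \<eta> A1 A2"
    and "\<eta> \<le> 1 / 2"
  shows "G_II M A1 A2 1 = 1"
proof -
  interpret prob_space M
    using assms(4) by (simp add: random_walk_approximation_def)
  have walk1: "p_walk M \<eta> (int l - 1) A1" and walk2: "p_walk M (1 - \<eta>) (int l - 1) A2"
    using assms(4) by (simp_all add: random_walk_approximation_def)
  note [measurable] = p_walk_measurable[OF walk1] p_walk_measurable[OF walk2]
  have meas: "{\<omega>\<in>space M. stop_A2 A1 A2 \<omega> = enat k} \<in> events" for k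
    unfolding stop_A2_alt stop_A1_def first_time_eq_enat_iff by measurable
  \<comment> \<open>As \<open>l \<ge> 1\<close>, the start is a natural number, the form in which
    the hitting result is stated.\<close>
  have walk1': "p_walk M \<eta> (int (l - 1)) A1"
    using walk1 assms(1) by (simp add: of_nat_diff)
  have start: "A1 0 \<omega> = int l - 1" "A2 0 \<omega> = int l - 1" if "\<omega> \<in> space M" for \<omega>
    using walk1 walk2 that by (simp_all add: p_walk_def)
  have fin: "AE \<omega> in M. \<exists>k. stop_A2 A1 A2 \<omega> = enat k"
  proof -
    have "AE \<omega> in M. \<exists>t. A1 t \<omega> = 0"
      using assms by (intro p_walk_AE_hits_0[OF walk1']) auto
    \<comment> \<open>The second walk goes up with probability \<open>1 - \<eta>\<close>, which is
      below 1 because \<open>\<eta> > 0\<close>.\<close>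
    moreover have "AE \<omega> in M. \<forall>m. \<exists>t\<ge>m. A2 (Suc t) \<omega> - A2 t \<omega> = -1"
      using assms by (intro p_walk_AE_down_steps[OF walk2]) auto
    ultimately show ?thesis
      using p_walk_AE_step[OF walk1] p_walk_AE_step[OF walk2] AE_space
      by eventually_elim (rule stop_A2_finite, auto simp: start)
  qed
  \<comment> \<open>At \<open>s = 1\<close> the series adds the probabilities of disjoint events
    whose union is finiteness of the stopping time.\<close>
  have "(\<lambda>k. \<P>(\<omega> in M. stop_A2 A1 A2 \<omega> = enat k))
      sums prob (\<Union>k. {\<omega>\<in>space M. stop_A2 A1 A2 \<omega> = enat k})"
    using meas by (intro finite_measure_UNION) (auto simp: disjoint_family_on_def)
  moreover have "prob (\<Union>k. {\<omega>\<in>space M. stop_A2 A1 A2 \<omega> = enat k}) = 1"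
    by (rule prob_eq_1[THEN iffD2]) (use meas fin in auto)
  ultimately show ?thesis
    by (simp add: G_II_def sums_iff)
qed

end
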